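(* Let $q,\tilde q\in L^{1}(0,1)$ be real-valued, put $\hat q:=q-\tilde q$, and let $L=L(q)$ and $\tilde L=L(\tilde q)$ be the self-adjoint Sturm-Liouville operators in $L^2(0,1)$ generated by $-y''+qy$ and $-y''+\tilde q y$ respectively, with the same (arbitrary) self-adjoint boundary conditions. Let $\{\lambda_n\}_{n\ge 1}$ and $\{\tilde\lambda_n\}_{n\ge 1}$ be their eigenvalues, listed in nondecreasing order and counted with multiplicity. Suppose that for some $n\ge 1$ $$\lambda_n-\tilde\lambda_n=(\hat q\,\tilde y_n,\tilde y_n),$$ where $\tilde y_n$ is a normalized eigenfunction of $\tilde L$ related to the eigenvalue $\tilde\lambda_n$, and that, for the same $n$, $$\lambda_n-\tilde\lambda_n=\operatorname{ess\,inf}\hat q\quad\text{or}\quad \lambda_n-\tilde\lambda_n=\operatorname{ess\,sup}\hat q .$$ Then $q(x)=\tilde q(x)+\lambda_n-\tilde\lambda_n$ for almost every $x\in(0,1)$.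
   Context: For real-valued $q\in L^1(0,1)$, $L(q)$ denotes the operator in $L^2(0,1)$ generated by the differential equation $-y''(x)+q(x)y(x)=\lambda y(x)$ on $(0,1)$ with fixed but arbitrary self-adjoint boundary conditions at $0$ and $1$ (i.e. boundary conditions on $y(0),y(1),y'(0),y'(1)$ for which $L(q)$ is self-adjoint). Its spectrum is discrete, real and bounded from below; its eigenvalues form a sequence $\lambda_1\le\lambda_2\le\cdots$ with $\lambda_n\to+\infty$, counted with multiplicity. The operators $L(q)$ and $L(\tilde q)$ have the same boundary conditions. $(\cdot,\cdot)$ is the inner product of $L^2(0,1)$, so that $(\hat q\,\tilde y_n,\tilde y_n)=\int_0^1\hat q(x)|\tilde y_n(x)|^2\,dx$, and normalized means $\|\tilde y_n\|_{L^2(0,1)}=1$. The essential infimum and supremum are taken over $(0,1)$ with respect to Lebesgue measure. *)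

theory Defs
  imports "HOL-Probability.Essential_Supremum" "HOL-Library.Function_Algebras"
begin

abbreviation M01 :: "real measure" where
  "M01 \<equiv> lebesgue_on {0<..<1}"

text \<open>The complex Hilbert space \<open>L\<^sup>2(0,1)\<close> is handled through representatives: a vector is a
  square-integrable function, and every notion below is invariant under changes on null sets.\<close>

definition L2 :: "(real \<Rightarrow> complex) set" where
  "L2 = {f. f \<in> borel_measurable M01 \<and> integrable M01 (\<lambda>x. (cmod (f x))\<^sup>2)}"

definition L2_inner :: "(real \<Rightarrow> complex) \<Rightarrow> (real \<Rightarrow> complex) \<Rightarrow> complex" where
  "L2_inner f g = (LINT x|M01. f x * cnj (g x))"

definition L2_norm :: "(real \<Rightarrow> complex) \<Rightarrow> real" where
  "L2_norm f = sqrt (LINT x|M01. (cmod (f x))\<^sup>2)"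

text \<open>Unbounded operators in \<open>L\<^sup>2(0,1)\<close> are represented by their graphs.\<close>

type_synonym L2_graph = "((real \<Rightarrow> complex) \<times> (real \<Rightarrow> complex)) set"

definition densely_defined :: "L2_graph \<Rightarrow> bool" where
  "densely_defined T \<longleftrightarrow>
     (\<forall>f\<in>L2. \<forall>e>0. \<exists>u\<in>Domain T. L2_norm (\<lambda>x. f x - u x) < e)"

definition L2_adjoint :: "L2_graph \<Rightarrow> L2_graph" where
  "L2_adjoint T =
     {(u, v). u \<in> L2 \<and> v \<in> L2 \<and> (\<forall>(f, g)\<in>T. L2_inner g u = L2_inner f v)}"

definition L2_selfadjoint :: "L2_graph \<Rightarrow> bool" where
  "L2_selfadjoint T \<longleftrightarrow> densely_defined T \<and> L2_adjoint T = T"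

text \<open>Absolute continuity in the epsilon-delta sense; \<open>D\<close> ranges over the finite families of
  non-overlapping compact subintervals of \<open>S\<close>.\<close>

definition absolutely_continuous_on :: "real set \<Rightarrow> (real \<Rightarrow> complex) \<Rightarrow> bool" where
  "absolutely_continuous_on S f \<longleftrightarrow>
     (\<forall>e>0. \<exists>d>0. \<forall>D. D division_of \<Union>D \<longrightarrow> \<Union>D \<subseteq> S \<longrightarrow> (\<Sum>k\<in>D. Sup k - Inf k) < d
        \<longrightarrow> (\<Sum>k\<in>D. cmod (f (Sup k) - f (Inf k))) < e)"

text \<open>The operator generated by \<open>-y'' + q y\<close> on its usual domain: \<open>y\<close> is continuously
  differentiable on \<open>[0,1]\<close> (one-sidedly at the endpoints) with \<open>y'\<close> absolutely continuous,
  \<open>y\<close> satisfies the boundary conditions, and \<open>-y'' + q y\<close>, with \<open>y''\<close> the almost everywhere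
  derivative of \<open>y'\<close>, lies in \<open>L\<^sup>2(0,1)\<close>. The set \<open>W\<close> consists of the boundary values
  \<open>(y(0), y(1), y'(0), y'(1))\<close> that the boundary conditions admit. It is not required to be a
  linear subspace, since every self-adjoint graph is linear.\<close>

definition SL_op :: "(real \<Rightarrow> real) \<Rightarrow> (complex \<times> complex \<times> complex \<times> complex) set \<Rightarrow> L2_graph" where
  "SL_op q W =
     {(f, g). f \<in> L2 \<and> g \<in> L2 \<and>
        (\<exists>y y' y''.
           (\<forall>x\<in>{0..1}. (y has_vector_derivative y' x) (at x within {0..1})) \<and>
           absolutely_continuous_on {0..1} y' \<and>
           (AE x in M01. (y' has_vector_derivative y'' x) (at x)) \<and>
           (y 0, y 1, y' 0, y' 1) \<in> W \<and>
           (AE x in M01. f x = y x) \<and>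
           (AE x in M01. g x = - y'' x + complex_of_real (q x) * y x))}"

global_interpretation cfun: vector_space "\<lambda>(c::complex) (f::real \<Rightarrow> complex) x. c * f x"
  by unfold_locales (simp_all add: fun_eq_iff algebra_simps)

text \<open>So that functions equal almost everywhere are not counted as different vectors, the
  dimension is that of the space of the continuous representatives of the eigenvectors, extended
  by zero outside \<open>[0,1]\<close>.\<close>

definition multiplicity_of :: "L2_graph \<Rightarrow> complex \<Rightarrow> nat" where
  "multiplicity_of T z =
     cfun.dim {f. (f, \<lambda>x. z * f x) \<in> T \<and> continuous_on {0..1} f \<and> (\<forall>x. x \<notin> {0..1} \<longrightarrow> f x = 0)}"

text \<open>\<open>lam 1 \<le> lam 2 \<le> \<dots>\<close> are the eigenvalues of \<open>T\<close>, each repeated according to its multiplicity;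
  as \<open>z\<close> ranges over all complex numbers, nothing else is an eigenvalue. The entry
  \<open>lam 0\<close> is not used.\<close>

definition eigenvalue_sequence :: "L2_graph \<Rightarrow> (nat \<Rightarrow> real) \<Rightarrow> bool" where
  "eigenvalue_sequence T lam \<longleftrightarrow>
     (\<forall>m n. 1 \<le> m \<longrightarrow> m \<le> n \<longrightarrow> lam m \<le> lam n) \<and>
     (\<forall>z. finite {n. 1 \<le> n \<and> complex_of_real (lam n) = z} \<and>
          card {n. 1 \<le> n \<and> complex_of_real (lam n) = z} = multiplicity_of T z)"

definition normalized_eigenfunction :: "L2_graph \<Rightarrow> complex \<Rightarrow> (real \<Rightarrow> complex) \<Rightarrow> bool" where
  "normalized_eigenfunction T z f \<longleftrightarrow> (f, \<lambda>x. z * f x) \<in> T \<and> L2_norm f = 1"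

definition essinf :: "'a measure \<Rightarrow> ('a \<Rightarrow> ereal) \<Rightarrow> ereal" where
  "essinf M f = - esssup M (\<lambda>x. - f x)"

end

theory Submission
  imports Defs
begin

text \<open>
  Write \<open>c = lam n - lamt n\<close> and \<open>g = q - qt\<close>. The first hypothesis on \<open>c\<close> says that \<open>c\<close> is the
  mean of \<open>g\<close> with respect to the probability density \<open>\<bar>yt\<bar>\<^sup>2\<close>, the second that \<open>c\<close> is an essential
  bound of \<open>g\<close>, from below or from above. Hence \<open>\<plusminus>(g - c)\<bar>yt\<bar>\<^sup>2\<close> is a nonnegative function with
  integral zero, so it vanishes almost everywhere (\<open>weighted_mean_eq_lower_bound\<close>), and \<open>g = c\<close>
  wherever \<open>yt \<noteq> 0\<close>. It remains to see that an eigenfunction is nonzero almost everywhere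
  (\<open>eigenfunction_bounded_nonzero\<close>).

  In fact it has only finitely many zeros in \<open>[0,1]\<close> (\<open>finite_zeros_second_order_linear\<close>). Infinitely
  many zeros would accumulate at some \<open>x0\<close>, where both \<open>y\<close> and \<open>y'\<close> vanish. Since
  \<open>y\<close> solves \<open>y'' = p y\<close> with \<open>p = qt - lamt n\<close> integrable, this initial value determines it, and
  \<open>y\<close> vanishes identically, which contradicts \<open>\<parallel>y\<parallel> = 1\<close>. As \<open>y\<close> is complex-valued, Rolle's
  theorem is of no help here, but accumulation of zeros forces \<open>y' x0 = 0\<close> all the same.

  The uniqueness argument integrates the differential equation. As \<open>y'\<close> is only absolutely
  continuous and \<open>y''\<close> exists only almost everywhere, this needs the fundamental theorem of calculus
  for absolutely continuous functions (\<open>absolutely_continuous_on_has_integral\<close>).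
\<close>


section \<open>The fundamental theorem of calculus for absolutely continuous functions\<close>

text \<open>The gauge integral gives a direct proof. Where \<open>f\<close> is differentiable, the gauge makes the
  increment of \<open>f\<close> over a cell close to the derivative times the length of the cell, as in the
  classical theorem. The exceptional set \<open>N\<close> lies in an open set of small measure, and the gauge
  confines the cells with tags in \<open>N\<close> to it; the total length of these cells is then small, so
  absolute continuity makes the sum of the increments over them small.\<close>

lemma absolutely_continuous_on_has_integral:
  fixes f f' :: "real \<Rightarrow> complex"
  assumes ac: "absolutely_continuous_on {a..b} f" and "a \<le> b" and N: "negligible N"
    and deriv: "\<And>x. x \<in> {a..b} - N \<Longrightarrow> (f has_vector_derivative f' x) (at x within {a..b})"
  shows "(f' has_integral f b - f a) {a..b}"
proof -
  \<comment> \<open>The values on \<open>N\<close> are set to zero, so that tags in \<open>N\<close> contribute nothing to Riemann sums.\<close>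
  define g where "g x = (if x \<in> N then 0 else f' x)" for x
  have "(g has_integral f b - f a) {a..b}"
    unfolding has_integral_real
  proof (intro allI impI)
    fix e :: real assume "e > 0"
    \<comment> \<open>The \<open>+ 1\<close> in the denominator covers the case \<open>a = b\<close>.\<close>
    define e1 where "e1 = e / (2 * (b - a + 1))"
    have "e1 > 0" and e1: "e1 * (b - a) < e / 2"
      using \<open>e > 0\<close> \<open>a \<le> b\<close> by (simp_all add: e1_def field_simps)
    obtain d where "d > 0" and d: "\<forall>D. D division_of \<Union>D \<longrightarrow> \<Union>D \<subseteq> {a..b} \<longrightarrow>
        (\<Sum>k\<in>D. Sup k - Inf k) < d \<longrightarrow> (\<Sum>k\<in>D. cmod (f (Sup k) - f (Inf k))) < e / 2"
      using ac[unfolded absolutely_continuous_on_def, THEN spec, THEN mp, of "e / 2"] \<open>e > 0\<close>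
      by auto
    obtain G where G: "open G" "N \<subseteq> G" "G - N \<in> lmeasurable"
        "emeasure lebesgue (G - N) < ennreal d"
      using sets_lebesgue_outer_open[of N d] N \<open>d > 0\<close>
      by (metis fmeasurableD negligible_imp_measurable)
    have G_meas: "G \<in> lmeasurable"
      using fmeasurable.Un[OF G(3) negligible_imp_measurable[OF N]] \<open>N \<subseteq> G\<close>
      by (simp add: Un_absorb2)
    have "measure lebesgue (G - N) < d"
      using G(3,4) \<open>d > 0\<close>
      by (simp add: emeasure_eq_measure2 ennreal_less_iff)
    moreover have "measure lebesgue (G - N) = measure lebesgue G"
      using N G_meas by (simp add: measure_Diff_null_set fmeasurableD negligible_iff_null_sets)
    ultimately have G_small: "measure lebesgue G < d" by simp
    have "\<exists>r>0. \<forall>y\<in>{a..b}. \<bar>y - x\<bar> < r \<longrightarrow>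
        norm (f y - f x - (y - x) *\<^sub>R f' x) \<le> e1 * \<bar>y - x\<bar>" if "x \<in> {a..b} - N" for x
      using deriv[OF that] \<open>e1 > 0\<close>
      by (auto simp: has_vector_derivative_def has_derivative_within_alt)
    then obtain r where r: "\<And>x. x \<in> {a..b} - N \<Longrightarrow> r x > 0"
      "\<And>x y. x \<in> {a..b} - N \<Longrightarrow> y \<in> {a..b} \<Longrightarrow> \<bar>y - x\<bar> < r x \<Longrightarrow>
         norm (f y - f x - (y - x) *\<^sub>R f' x) \<le> e1 * \<bar>y - x\<bar>"
      by metis
    define \<gamma> where
      "\<gamma> x = (if x \<in> N then G else if x \<in> {a..b} then ball x (r x) else UNIV)" for x
    have gauge: "gauge \<gamma>"
      using G r(1) by (auto simp: gauge_def \<gamma>_def)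
    have close: "norm ((\<Sum>(x,k)\<in>D. measure lborel k *\<^sub>R g x) - (f b - f a)) < e"
      if D: "D tagged_division_of {a..b}" and fine: "\<gamma> fine D" for D
    proof -
      have "finite D" using D by blast
      define A where "A = {(x, k) \<in> D. x \<in> N}"
      have "A \<subseteq> D" by (auto simp: A_def)
      have A_part: "A tagged_partial_division_of {a..b}"
        using D[unfolded tagged_division_of_def, THEN conjunct1] \<open>A \<subseteq> D\<close>
        by (rule tagged_partial_division_subset)
      define h where "h = (\<lambda>(x::real, k). f (Sup k) - f (Inf k) - measure lborel k *\<^sub>R g x)"
      have cell: "\<exists>u v. k = {u..v} \<and> u \<le> v \<and> x \<in> {u..v} \<and> {u..v} \<subseteq> {a..b} \<and> {u..v} \<subseteq> \<gamma> x"
        if "(x, k) \<in> D" for x k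
      proof -
        obtain u v where "k = cbox u v" using tagged_division_ofD(4)[OF D \<open>(x, k) \<in> D\<close>] by blast
        moreover have "x \<in> k" "k \<subseteq> {a..b}" using tagged_division_ofD(2,3)[OF D that] by auto
        moreover have "k \<subseteq> \<gamma> x" using fineD[OF fine that] .
        ultimately show ?thesis by (intro exI[of _ u] exI[of _ v]) auto
      qed
      have bad: "(\<Sum>p\<in>A. norm (h p)) < e / 2"
      proof -
        let ?D = "snd ` A"
        have tag: "A tagged_division_of \<Union>?D"
          using tagged_partial_division_of_Union_self[OF A_part] .
        then have div: "?D division_of \<Union>?D" by (rule division_of_tagged_division)
        have sub: "\<Union>?D \<subseteq> {a..b}" and subG: "\<Union>?D \<subseteq> G"
          using cell \<open>A \<subseteq> D\<close> by (fastforce simp: A_def \<gamma>_def)+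
        have "(\<Sum>k\<in>?D. Sup k - Inf k) = (\<Sum>k\<in>?D. measure lebesgue k)"
          using cell \<open>A \<subseteq> D\<close> by (intro sum.cong) fastforce+
        also have "\<dots> = measure lebesgue (\<Union>?D)" using content_division[OF div] .
        also have "\<dots> \<le> measure lebesgue G"
          using lmeasurable_division[OF div] subG G_meas
          by (intro measure_mono_fmeasurable) (auto dest: fmeasurableD)
        finally have "(\<Sum>k\<in>?D. Sup k - Inf k) < d" using G_small by simp
        then have *: "(\<Sum>k\<in>?D. cmod (f (Sup k) - f (Inf k))) < e / 2"
          using d div sub by blast
        \<comment> \<open>\<open>Sup {}\<close> and \<open>Inf {}\<close> are arbitrary reals, hence the case of the empty cell, which is
          needed to pass from tagged to untagged divisions.\<close>
        let ?incr = "\<lambda>k. if k = {} then 0 else cmod (f (Sup k) - f (Inf k))"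
        have "(\<Sum>p\<in>A. norm (h p)) = (\<Sum>(x, k)\<in>A. cmod (f (Sup k) - f (Inf k)))"
          by (intro sum.cong) (auto simp: A_def h_def g_def)
        also have "\<dots> = (\<Sum>(x, k)\<in>A. ?incr k)"
          using cell \<open>A \<subseteq> D\<close> by (intro sum.cong) fastforce+
        also have "\<dots> = (\<Sum>k\<in>?D. ?incr k)"
        proof (rule sum.over_tagged_division_lemma[OF tag])
          fix u v :: real assume "box u v = {}"
          then have "u \<ge> v" by simp
          then show "?incr (cbox u v) = 0"
            by (cases "u = v") auto
        qed
        also have "\<dots> \<le> (\<Sum>k\<in>?D. cmod (f (Sup k) - f (Inf k)))"
          by (intro sum_mono) simp
        finally show ?thesis using * by simp
      qed
      have good: "norm (h (x, k)) \<le> e1 * measure lborel k" if "(x, k) \<in> D - A" for x k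
      proof -
        obtain u v where k: "k = {u..v}" "u \<le> v" "x \<in> {u..v}" "{u..v} \<subseteq> {a..b}" "{u..v} \<subseteq> \<gamma> x"
          using cell \<open>(x, k) \<in> D - A\<close> by blast
        have x: "x \<in> {a..b} - N" using k that by (auto simp: A_def)
        have "u \<in> {a..b}" "v \<in> {a..b}" "u \<in> \<gamma> x" "v \<in> \<gamma> x" using k by auto
        then have "norm (f v - f x - (v - x) *\<^sub>R f' x) \<le> e1 * \<bar>v - x\<bar>"
          and "norm (f u - f x - (u - x) *\<^sub>R f' x) \<le> e1 * \<bar>u - x\<bar>"
          using r(2)[OF x] x by (auto simp: \<gamma>_def dist_real_def abs_minus_commute)
        moreover have eq: "h (x, k) = (f v - f x - (v - x) *\<^sub>R f' x) - (f u - f x - (u - x) *\<^sub>R f' x)"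
          using k x by (simp add: h_def g_def algebra_simps)
        ultimately have "norm (h (x, k)) \<le> e1 * \<bar>v - x\<bar> + e1 * \<bar>u - x\<bar>"
          unfolding eq by (intro order_trans[OF norm_triangle_ineq4 add_mono])
        also have "\<dots> = e1 * measure lborel k" using k by (simp add: algebra_simps)
        finally show ?thesis .
      qed
      have "(\<Sum>p\<in>D - A. norm (h p)) \<le> (\<Sum>(x, k)\<in>D - A. e1 * measure lborel k)"
        using good by (intro sum_mono) auto
      also have "\<dots> \<le> (\<Sum>(x, k)\<in>D. e1 * measure lborel k)"
        using \<open>finite D\<close> \<open>e1 > 0\<close> by (intro sum_mono2) auto
      also have "\<dots> = e1 * (b - a)"
        using additive_content_tagged_division[of D a b] D \<open>a \<le> b\<close>
        by (simp add: sum_distrib_left[symmetric] case_prod_unfold)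
      finally have rest: "(\<Sum>p\<in>D - A. norm (h p)) < e / 2" using e1 by simp
      have "f b - f a - (\<Sum>(x,k)\<in>D. measure lborel k *\<^sub>R g x) = sum h D"
        using additive_tagged_division_1[OF \<open>a \<le> b\<close> D, of f]
        by (simp add: h_def case_prod_unfold sum_subtractf)
      then have "norm ((\<Sum>(x,k)\<in>D. measure lborel k *\<^sub>R g x) - (f b - f a)) = norm (sum h D)"
        by (metis norm_minus_commute)
      also have "\<dots> \<le> (\<Sum>p\<in>D. norm (h p))" by (rule norm_sum)
      also have "\<dots> = (\<Sum>p\<in>D - A. norm (h p)) + (\<Sum>p\<in>A. norm (h p))"
        using \<open>finite D\<close> \<open>A \<subseteq> D\<close> by (rule sum.subset_diff[rotated])
      finally show ?thesis using bad rest by simp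
    qed
    show "\<exists>\<gamma>. gauge \<gamma> \<and> (\<forall>D. D tagged_division_of {a..b} \<and> \<gamma> fine D \<longrightarrow>
        norm ((\<Sum>(x,k)\<in>D. measure lborel k *\<^sub>R g x) - (f b - f a)) < e)"
      by (intro exI[of _ \<gamma>] conjI allI impI gauge close) simp_all
  qed
  then show ?thesis
    by (rule has_integral_spike[OF N, rotated]) (auto simp: g_def)
qed

lemma absolutely_continuous_on_subset:
  assumes "absolutely_continuous_on S f" "T \<subseteq> S"
  shows "absolutely_continuous_on T f"
  using assms unfolding absolutely_continuous_on_def by (meson order_trans)

section \<open>Zeros of solutions of linear equations with integrable coefficients\<close>

text \<open>A form of Gronwall's uniqueness argument: the hypothesis on increments is what
  \<open>\<bar>w'\<bar> \<le> k \<bar>w\<bar>\<close> gives after integration. On an interval around a zero of \<open>w\<close> over which the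
  integral of \<open>k\<close> is less than \<open>1\<close>, the maximum of \<open>\<bar>w\<bar>\<close> is at most that integral times itself,
  so it is zero. The zero set of \<open>w\<close> is therefore open as well as closed in the connected
  interval \<open>[a,b]\<close>.\<close>

lemma vanishes_if_increments_controlled:
  fixes w :: "real \<Rightarrow> 'a :: real_normed_vector" and k :: "real \<Rightarrow> real"
  assumes cont: "continuous_on {a..b} w" and k: "k integrable_on {a..b}"
    and k_nonneg: "\<And>x. k x \<ge> 0"
    and incr: "\<And>s t M. \<lbrakk>a \<le> s; s \<le> t; t \<le> b; \<And>x. x \<in> {s..t} \<Longrightarrow> norm (w x) \<le> M\<rbrakk>
                 \<Longrightarrow> norm (w t - w s) \<le> M * integral {s..t} k"
    and x0: "x0 \<in> {a..b}" "w x0 = 0" and "x \<in> {a..b}"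
  shows "w x = 0"
proof -
  define Z where "Z = {x \<in> {a..b}. w x = 0}"
  have locally: "\<exists>d>0. \<forall>x\<in>{a..b}. \<bar>x - z\<bar> < d \<longrightarrow> w x = 0" if "z \<in> Z" for z
  proof -
    have z: "z \<in> {a..b}" "w z = 0" using that by (auto simp: Z_def)
    define F where "F t = integral {a..t} k" for t
    have "continuous_on {a..b} F" unfolding F_def using k by (rule indefinite_integral_continuous_1)
    then obtain d where "d > 0"
      and d: "\<And>x. x \<in> {a..b} \<Longrightarrow> \<bar>x - z\<bar> < d \<Longrightarrow> \<bar>F x - F z\<bar> < 1 / 2"
      using z(1) unfolding continuous_on_iff dist_real_def by (metis half_gt_zero zero_less_one)
    define l r where "l = max a (z - d / 2)" and "r = min b (z + d / 2)"
    have lr: "a \<le> l" "l \<le> z" "z \<le> r" "r \<le> b" "\<bar>l - z\<bar> < d" "\<bar>r - z\<bar> < d"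
      using z(1) \<open>d > 0\<close> by (auto simp: l_def r_def)
    have k_lr: "k integrable_on {s..t}" if "a \<le> s" "t \<le> b" for s t
      using integrable_subinterval_real[OF k] that by simp
    have "F l + integral {l..r} k = F r"
      unfolding F_def using lr by (intro Henstock_Kurzweil_Integration.integral_combine k_lr) auto
    then have small: "integral {l..r} k < 1"
      using d[of l] d[of r] lr by (simp add: abs_if split: if_splits)
    have "continuous_on {l..r} (\<lambda>x. norm (w x))"
      using lr by (intro continuous_on_norm continuous_on_subset[OF cont]) auto
    then obtain m where m: "m \<in> {l..r}" "\<And>x. x \<in> {l..r} \<Longrightarrow> norm (w x) \<le> norm (w m)"
      using continuous_attains_sup[OF compact_Icc, of l r] lr by force
    have mono: "integral {s..t} k \<le> integral {l..r} k" if "l \<le> s" "t \<le> r" for s t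
      using that lr k_nonneg by (intro integral_subset_le k_lr) auto
    have bound: "norm (w m) * integral {s..t} k \<le> norm (w m) * integral {l..r} k"
      if "l \<le> s" "t \<le> r" for s t
      using mono[OF that] by (simp add: mult_left_mono)
    have "norm (w m) \<le> norm (w m) * integral {l..r} k"
    proof (cases "z \<le> m")
      case True
      with incr[of z m "norm (w m)"] bound[of z m] m lr z show ?thesis by force
    next
      case False
      with incr[of m z "norm (w m)"] bound[of m z] m lr z show ?thesis by force
    qed
    then have "norm (w m) = 0"
      using small by (smt (verit, best) mult_less_cancel_left2 norm_ge_zero)
    then have "w x = 0" if "x \<in> {l..r}" for x using m(2)[OF that] by simp
    then have "\<forall>x\<in>{a..b}. \<bar>x - z\<bar> < d / 2 \<longrightarrow> w x = 0"
      unfolding l_def r_def by (auto simp: abs_if split: if_splits)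
    then show ?thesis using \<open>d > 0\<close> half_gt_zero by blast
  qed
  have "openin (top_of_set {a..b}) Z"
    unfolding openin_euclidean_subtopology_iff
    using locally by (fastforce simp: Z_def dist_real_def)
  moreover have "closedin (top_of_set {a..b}) Z"
    unfolding Z_def by (rule continuous_closedin_preimage_constant[OF cont])
  moreover have "Z \<noteq> {}" using x0 by (auto simp: Z_def)
  ultimately have "Z = {a..b}"
    using connected_Icc[of a b] unfolding connected_clopen by blast
  then have "x \<in> Z" using \<open>x \<in> {a..b}\<close> by simp
  then show ?thesis by (simp add: Z_def)
qed

text \<open>The double zero is an accumulation point of the zero set: within that set \<open>y\<close> is constant,
  so its derivative there can only be zero.\<close>

lemma infinite_zeros_imp_double_zero:
  fixes y :: "real \<Rightarrow> 'a :: real_normed_vector"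
  assumes deriv: "\<And>x. x \<in> {a..b} \<Longrightarrow> (y has_vector_derivative y' x) (at x within {a..b})"
    and inf: "infinite {x \<in> {a..b}. y x = 0}"
  obtains x where "x \<in> {a..b}" "y x = 0" "y' x = 0"
proof -
  define Z where "Z = {x \<in> {a..b}. y x = 0}"
  obtain x where x: "x \<in> {a..b}" "x islimpt Z"
    using Heine_Borel_imp_Bolzano_Weierstrass[OF compact_Icc, of Z a b] inf
    unfolding Z_def by blast
  have cont: "continuous_on {a..b} y"
    using deriv has_vector_derivative_continuous continuous_on_eq_continuous_within by blast
  have "closed Z"
    unfolding Z_def
    using continuous_closed_preimage_constant[OF cont closed_real_atLeastAtMost] .
  then have "x \<in> Z" using x(2) closed_limpt by blast
  have "(y has_vector_derivative y' x) (at x within Z)"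
    using deriv[OF x(1)] by (rule has_vector_derivative_within_subset) (auto simp: Z_def)
  moreover have "(y has_vector_derivative 0) (at x within Z)"
    using \<open>x \<in> Z\<close>
    by (intro has_vector_derivative_transform[OF _ _ has_vector_derivative_const[of 0]])
      (auto simp: Z_def)
  ultimately have "y' x = 0"
    using x(2) by (intro vector_derivative_unique_within) (auto simp: trivial_limit_within)
  with that \<open>x \<in> Z\<close> show ?thesis by (auto simp: Z_def)
qed

text \<open>The equation \<open>y'' = p y\<close> is a first order system for \<open>w = (y, y')\<close> with
  \<open>\<bar>w'\<bar> \<le> (1 + \<bar>p\<bar>) \<bar>w\<bar>\<close>, so that \<open>w\<close> vanishes identically if it vanishes at one point.\<close>

lemma finite_zeros_second_order_linear:
  fixes y y' :: "real \<Rightarrow> complex" and p :: "real \<Rightarrow> complex"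
  assumes deriv: "\<And>x. x \<in> {a..b} \<Longrightarrow> (y has_vector_derivative y' x) (at x within {a..b})"
    and ac: "absolutely_continuous_on {a..b} y'" and N: "negligible N"
    and eq: "\<And>x. x \<in> {a..b} - N \<Longrightarrow> (y' has_vector_derivative p x * y x) (at x within {a..b})"
    and p: "(\<lambda>x. norm (p x)) integrable_on {a..b}"
    and nontrivial: "c \<in> {a..b}" "y c \<noteq> 0"
  shows "finite {x \<in> {a..b}. y x = 0}"
proof (rule ccontr)
  assume "infinite {x \<in> {a..b}. y x = 0}"
  then obtain x0 where x0: "x0 \<in> {a..b}" "y x0 = 0" "y' x0 = 0"
    using infinite_zeros_imp_double_zero[OF deriv] by blast
  define k where "k x = 1 + norm (p x)" for x
  have k: "k integrable_on {a..b}"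
    unfolding k_def by (intro integrable_add p) auto
  define w where "w x = (y x, y' x)" for x
  have ftc': "((\<lambda>x. p x * y x) has_integral y' t - y' s) {s..t}" if "a \<le> s" "s \<le> t" "t \<le> b" for s t
  proof (rule absolutely_continuous_on_has_integral[OF _ that(2) N])
    show "absolutely_continuous_on {s..t} y'"
      using ac that by (elim absolutely_continuous_on_subset) auto
    show "(y' has_vector_derivative p x * y x) (at x within {s..t})" if "x \<in> {s..t} - N" for x
      using that \<open>a \<le> s\<close> \<open>t \<le> b\<close> by (intro has_vector_derivative_within_subset[OF eq]) auto
  qed
  have ftc: "(y' has_integral y t - y s) {s..t}" if "a \<le> s" "s \<le> t" "t \<le> b" for s t
    using that by (intro fundamental_theorem_of_calculus has_vector_derivative_within_subset[OF deriv]) auto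
  have "w c = 0"
  proof (rule vanishes_if_increments_controlled[OF _ k _ _ x0(1) _ nontrivial(1)])
    \<comment> \<open>Continuity of \<open>y'\<close> is read off from its representation as an indefinite integral.\<close>
    have "continuous_on {a..b} (\<lambda>x. y' a + integral {a..x} (\<lambda>x. p x * y x))"
      using ftc'[of a b] x0(1)
      by (intro continuous_intros indefinite_integral_continuous_1) auto
    then have "continuous_on {a..b} y'"
      by (rule continuous_on_eq) (simp add: integral_unique[OF ftc'[of a]])
    moreover have "continuous_on {a..b} y"
      using deriv has_vector_derivative_continuous continuous_on_eq_continuous_within by blast
    ultimately show "continuous_on {a..b} w"
      unfolding w_def by (intro continuous_on_Pair)
    show "k x \<ge> 0" for x by (simp add: k_def)
    show "w x0 = 0" using x0 by (simp add: w_def zero_prod_def)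
    show "norm (w t - w s) \<le> M * integral {s..t} k"
      if st: "a \<le> s" "s \<le> t" "t \<le> b" and M: "\<And>x. x \<in> {s..t} \<Longrightarrow> norm (w x) \<le> M" for s t M
    proof -
      have p': "(\<lambda>x. norm (p x)) integrable_on {s..t}"
        using st by (intro integrable_subinterval_real[OF p]) auto
      have yM: "norm (y x) \<le> M" and y'M: "norm (y' x) \<le> M" if "x \<in> {s..t}" for x
        using M[OF that] norm_fst_le[of "y x" "y' x"] norm_snd_le[of "y' x" "y x"]
        by (auto simp: w_def)
      have "norm (y t - y s) \<le> integral {s..t} (\<lambda>x. M)"
        using ftc[OF st] y'M by (metis integral_norm_bound_integral has_integral_iff integrable_const_ivl)
      moreover have Mp: "(\<lambda>x. M * norm (p x)) integrable_on {s..t}"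
        using integrable_cmul[OF p', of M] by simp
      moreover have "norm (y' t - y' s) \<le> integral {s..t} (\<lambda>x. M * norm (p x))"
      proof -
        have "norm (integral {s..t} (\<lambda>x. p x * y x)) \<le> integral {s..t} (\<lambda>x. M * norm (p x))"
          using ftc'[OF st] Mp yM
          by (intro integral_norm_bound_integral)
            (auto simp: norm_mult mult.commute[of M] intro!: mult_left_mono)
        then show ?thesis using ftc'[OF st] by (simp add: integral_unique)
      qed
      moreover have "norm (w t - w s) \<le> norm (y t - y s) + norm (y' t - y' s)"
        unfolding w_def using norm_Pair_le[of "y t - y s" "y' t - y' s"] by simp
      moreover have "integral {s..t} (\<lambda>x. M) + integral {s..t} (\<lambda>x. M * norm (p x))
          = integral {s..t} (\<lambda>x. M * k x)"
        using Mp by (subst Henstock_Kurzweil_Integration.integral_add[symmetric]) (auto simp: k_def algebra_simps)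
      ultimately show ?thesis by simp
    qed
  qed
  with nontrivial(2) show False by (simp add: w_def zero_prod_def)
qed

section \<open>Eigenfunctions and weighted means\<close>

text \<open>The endpoints \<open>0\<close> and \<open>1\<close> are put into the exceptional set, so that a property known almost
  everywhere on the open interval can be used on the closed one.\<close>

lemma AE_M01_negligible:
  assumes "AE x in M01. P x"
  shows "negligible {x \<in> {0..1}. \<not> (x \<in> {0<..<1} \<and> P x)}"
proof -
  have "AE x in lebesgue. x \<in> {0<..<1} \<longrightarrow> P x"
    using assms by (subst (asm) AE_restrict_space_iff) auto
  then have "negligible {x. \<not> (x \<in> {0<..<1} \<longrightarrow> P x)}"
    by (simp add: completion.AE_iff_null_sets negligible_iff_null_sets)
  then have "negligible ({x. \<not> (x \<in> {0<..<1} \<longrightarrow> P x)} \<union> {0, 1})"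
    by (intro negligible_Un) auto
  then show ?thesis by (rule negligible_subset) auto
qed

lemma finite_imp_AE_M01_not_in:
  assumes "finite Z"
  shows "AE x in M01. x \<notin> Z"
proof -
  have "AE x in lebesgue. x \<notin> Z"
    using negligible_finite[OF assms]
    by (simp add: completion.AE_iff_null_sets negligible_iff_null_sets)
  then show ?thesis by (subst AE_restrict_space_iff) auto
qed

text \<open>Both claims come from the continuously differentiable representative \<open>y\<close> of \<open>f\<close>. The
  eigenvalue equation says \<open>y'' = (q - z) y\<close> almost everywhere, and \<open>y\<close> is not identically zero
  since \<open>f\<close> has norm \<open>1\<close>. The bound makes \<open>h \<bar>f\<bar>\<^sup>2\<close> integrable for
  every integrable \<open>h\<close>.\<close>

lemma eigenfunction_bounded_nonzero:
  assumes q: "integrable M01 q"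
    and f: "normalized_eigenfunction (SL_op q W) z f"
  shows "AE x in M01. f x \<noteq> 0" and "\<exists>B. AE x in M01. cmod (f x) \<le> B"
proof -
  from f have "(f, \<lambda>x. z * f x) \<in> SL_op q W" and norm1: "L2_norm f = 1"
    by (simp_all add: normalized_eigenfunction_def)
  then obtain y y' y'' where
      deriv: "\<And>x. x \<in> {0..1} \<Longrightarrow> (y has_vector_derivative y' x) (at x within {0..1})"
    and ac: "absolutely_continuous_on {0..1} y'"
    and y'': "AE x in M01. (y' has_vector_derivative y'' x) (at x)"
    and fy: "AE x in M01. f x = y x"
    and eq: "AE x in M01. z * f x = - y'' x + complex_of_real (q x) * y x"
    unfolding SL_op_def by blast
  have cont: "continuous_on {0..1} y"
    using deriv has_vector_derivative_continuous continuous_on_eq_continuous_within by blast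
  define p where "p x = complex_of_real (q x) - z" for x
  define N where "N = {x \<in> {0..1}. \<not> (x \<in> {0<..<1} \<and> (y' has_vector_derivative p x * y x) (at x))}"
  have "AE x in M01. (y' has_vector_derivative p x * y x) (at x)"
    using y'' fy eq
  proof eventually_elim
    case (elim x)
    then have "y'' x = p x * y x" by (simp add: p_def algebra_simps)
    with elim show ?case by simp
  qed
  then have N: "negligible N" unfolding N_def by (rule AE_M01_negligible)
  have "integrable M01 (\<lambda>x. norm (p x))"
    unfolding p_def using q
    by (intro integrable_norm Bochner_Integration.integrable_diff integrable_of_real)
      (auto intro!: finite_measure.integrable_const finite_measure_lebesgue_on)
  then have "(\<lambda>x. norm (p x)) integrable_on {0<..<1}"
    by (rule integrable_on_lebesgue_on) simp
  then have p: "(\<lambda>x. norm (p x)) integrable_on {0..1}"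
    by (simp add: integrable_on_Icc_iff_Ioo)
  have "\<exists>c\<in>{0..1}. y c \<noteq> 0"
  proof (rule ccontr)
    assume "\<not> (\<exists>c\<in>{0..1}. y c \<noteq> 0)"
    moreover have "AE x in M01. x \<in> {0..1}" by (auto intro!: AE_I2)
    ultimately have "AE x in M01. (cmod (f x))\<^sup>2 = 0" using fy by auto
    then have "(LINT x|M01. (cmod (f x))\<^sup>2) = 0" by (rule integral_eq_zero_AE)
    then show False using norm1 by (simp add: L2_norm_def)
  qed
  then obtain c where c: "c \<in> {0..1}" "y c \<noteq> 0" by blast
  have "finite {x \<in> {0..1}. y x = 0}"
    by (rule finite_zeros_second_order_linear[OF deriv ac N _ p c])
      (auto simp: N_def intro: has_vector_derivative_at_within)
  then have "AE x in M01. x \<notin> {x \<in> {0..1}. y x = 0}" by (rule finite_imp_AE_M01_not_in)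
  moreover have inside: "AE x in M01. x \<in> {0..1}" by (auto intro!: AE_I2)
  ultimately show "AE x in M01. f x \<noteq> 0" using fy by eventually_elim auto
  obtain B where B: "\<forall>x\<in>{0..1}. cmod (y x) \<le> B"
    using compact_imp_bounded[OF compact_continuous_image[OF cont compact_Icc]]
    unfolding bounded_iff by blast
  have "AE x in M01. cmod (f x) \<le> B" using fy inside by eventually_elim (use B in auto)
  then show "\<exists>B. AE x in M01. cmod (f x) \<le> B" ..
qed

text \<open>A mean with positive weights equals a lower bound only if the averaged function is constant:
  \<open>(g - c) w\<close> is nonnegative and its integral is \<open>c - c\<close>.\<close>

lemma weighted_mean_eq_lower_bound:
  fixes g w :: "'a \<Rightarrow> real"
  assumes "integrable M w" "integrable M (\<lambda>x. g x * w x)"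
    and "AE x in M. c \<le> g x" "AE x in M. w x > 0"
    and "(LINT x|M. w x) = 1" "(LINT x|M. g x * w x) = c"
  shows "AE x in M. g x = c"
proof -
  have int: "integrable M (\<lambda>x. g x * w x - c * w x)" using assms by auto
  have nonneg: "AE x in M. 0 \<le> g x * w x - c * w x"
    using assms(3,4) by eventually_elim (simp add: mult_right_mono)
  have "(LINT x|M. g x * w x - c * w x) = 0" using assms by simp
  then have "AE x in M. g x * w x - c * w x = 0"
    using integral_nonneg_eq_0_iff_AE[OF int nonneg] by simp
  with assms(4) show ?thesis by eventually_elim auto
qed

theorem theorem2p1:
  fixes q qt :: "real \<Rightarrow> real"
    and W :: "(complex \<times> complex \<times> complex \<times> complex) set"
    and lam lamt :: "nat \<Rightarrow> real"
    and n :: nat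
    and yt :: "real \<Rightarrow> complex"
  assumes "integrable M01 q" and "integrable M01 qt"
    and "L2_selfadjoint (SL_op q W)" and "L2_selfadjoint (SL_op qt W)"
    and "eigenvalue_sequence (SL_op q W) lam"
    and "eigenvalue_sequence (SL_op qt W) lamt"
    and "n \<ge> 1"
    and "normalized_eigenfunction (SL_op qt W) (complex_of_real (lamt n)) yt"
    and "complex_of_real (lam n - lamt n)
           = L2_inner (\<lambda>x. complex_of_real (q x - qt x) * yt x) yt"
    and "ereal (lam n - lamt n) = essinf M01 (\<lambda>x. ereal (q x - qt x)) \<or>
         ereal (lam n - lamt n) = esssup M01 (\<lambda>x. ereal (q x - qt x))"
  shows "AE x in M01. q x = qt x + lam n - lamt n"
proof -
  define c where "c = lam n - lamt n"
  define g where "g x = q x - qt x" for x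
  define w where "w x = (cmod (yt x))\<^sup>2" for x
  have "(yt, \<lambda>x. complex_of_real (lamt n) * yt x) \<in> SL_op qt W" and norm1: "L2_norm yt = 1"
    using assms(8) by (simp_all add: normalized_eigenfunction_def)
  then have meas: "yt \<in> borel_measurable M01" and w_int: "integrable M01 w"
    by (auto simp: SL_op_def L2_def w_def[abs_def])
  have g_int: "integrable M01 g" unfolding g_def using assms(1,2) by simp
  obtain B where B: "AE x in M01. cmod (yt x) \<le> B"
    using eigenfunction_bounded_nonzero(2)[OF assms(2,8)] by blast
  have w_pos: "AE x in M01. w x > 0"
    using eigenfunction_bounded_nonzero(1)[OF assms(2,8)] by eventually_elim (simp add: w_def)
  have gw_int: "integrable M01 (\<lambda>x. g x * w x)"
  proof (rule Bochner_Integration.integrable_bound)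
    show "integrable M01 (\<lambda>x. g x * B\<^sup>2)" using g_int by simp
    show "(\<lambda>x. g x * w x) \<in> borel_measurable M01"
      using g_int w_int by (intro borel_measurable_times) auto
    show "AE x in M01. norm (g x * w x) \<le> norm (g x * B\<^sup>2)"
      using B
      by eventually_elim (auto simp: w_def abs_mult intro!: mult_left_mono power_mono)
  qed
  have w_one: "(LINT x|M01. w x) = 1"
    using norm1 unfolding L2_norm_def w_def by simp
  have "L2_inner (\<lambda>x. complex_of_real (g x) * yt x) yt
      = (LINT x|M01. complex_of_real (g x * w x))"
    unfolding L2_inner_def w_def by (simp add: complex_norm_square mult.assoc del: of_real_power)
  also have "\<dots> = complex_of_real (LINT x|M01. g x * w x)" by (rule integral_complex_of_real)
  finally have gw: "(LINT x|M01. g x * w x) = c"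
    using assms(9) unfolding c_def g_def by (metis of_real_eq_iff)
  have "AE x in M01. g x = c"
    using assms(10)
  proof
    assume "ereal (lam n - lamt n) = essinf M01 (\<lambda>x. ereal (q x - qt x))"
    then have "esssup M01 (\<lambda>x. - ereal (g x)) = - ereal c"
      by (simp add: essinf_def c_def g_def ereal_uminus_eq_reorder)
    then have "AE x in M01. c \<le> g x"
      using esssup_AE[of "\<lambda>x. - ereal (g x)" M01] by simp
    then show ?thesis
      by (rule weighted_mean_eq_lower_bound[OF w_int gw_int _ w_pos w_one gw])
  next
    assume "ereal (lam n - lamt n) = esssup M01 (\<lambda>x. ereal (q x - qt x))"
    then have "esssup M01 (\<lambda>x. ereal (g x)) = ereal c"
      by (simp add: c_def g_def)
    then have "AE x in M01. - c \<le> - g x"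
      using esssup_AE[of "\<lambda>x. ereal (g x)" M01] by simp
    \<comment> \<open>An upper bound of \<open>g\<close> is a lower bound of \<open>- g\<close>.\<close>
    then have "AE x in M01. - g x = - c"
      using gw_int gw by (intro weighted_mean_eq_lower_bound[OF w_int _ _ w_pos w_one]) auto
    then show ?thesis by simp
  qed
  then show ?thesis by eventually_elim (simp add: c_def g_def)
qed

end
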